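(* Let $m,n\ge 2$ be integers of different parity. Then $$\int_{-1}^1P_n(x)P_m(x)\,dx=0.$$
   Context: For integers $n,k\ge 0$ let $$f(n,k,2,2)=\sum_{i=0}^n(-1)^i\binom{n}{i}\binom{2n+2-2i}{n+k},$$ where $\binom{a}{b}=0$ for $b>a\ge 0$, and put $f(n,k,2,2)=0$ if $n<0$. For $n\ge 2$ and $0\le k\le n$ let $c(n,k,2,2)=(-1)^{\frac{n-k}{2}}f\left(\frac{n+k-4}{2},\frac{n-k}{2},2,2\right)$ if $n$ and $k$ have the same parity, and $c(n,k,2,2)=0$ otherwise. The polynomial $P_n(x)$ is $P_n(x)=P_{n,2,2}(x)=\sum_{k=0}^n c(n,k,2,2)x^k$, $n\ge 2$. For example $P_2(x)=x^2$, $P_3(x)=2x^3-2x$, $P_4(x)=4x^4-5x^2+1$. *)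

theory Defs
  imports "HOL-Analysis.Analysis" "HOL-Computational_Algebra.Polynomial"
begin

text \<open>
  The first argument of \<open>f22\<close> is an integer because the value at negative \<open>n\<close> (namely 0)
  is used: the constant coefficient of \<open>P22 2\<close> is \<open>f22 (-1) 1\<close>. In the sum \<open>i \<le> n\<close>, so the
  natural subtraction \<open>2 * n + 2 - 2 * i\<close> does not truncate.
\<close>

definition f22 :: "int \<Rightarrow> nat \<Rightarrow> int" where
  "f22 n k = (if n < 0 then 0 else
     (\<Sum>i=0..nat n. (-1) ^ i * int (nat n choose i)
        * int ((2 * nat n + 2 - 2 * i) choose (nat n + k))))"

text \<open>Meaningful for \<open>n \<ge> 2\<close> and \<open>k \<le> n\<close>; both divisions by 2 are then exact.\<close>

definition c22 :: "nat \<Rightarrow> nat \<Rightarrow> int" where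
  "c22 n k = (if even n \<longleftrightarrow> even k
     then (-1) ^ ((n - k) div 2) * f22 ((int n + int k - 4) div 2) ((n - k) div 2)
     else 0)"

definition P22 :: "nat \<Rightarrow> real poly" where
  "P22 n = (\<Sum>k=0..n. monom (of_int (c22 n k)) k)"

lemma P22_2: "P22 2 = [:0, 0, 1:]"
proof -
  have "c22 2 0 = 0" "c22 2 1 = 0" "c22 2 2 = 1"
    by code_simp+
  then show ?thesis
    by (simp add: P22_def numeral_eq_Suc monom_Suc monom_0)
qed

lemma P22_3: "P22 3 = [:0, -2, 0, 2:]"
proof -
  have "c22 3 0 = 0" "c22 3 1 = -2" "c22 3 2 = 0" "c22 3 3 = 2"
    by code_simp+
  then show ?thesis
    by (simp add: P22_def numeral_eq_Suc monom_Suc monom_0)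
qed

lemma P22_4: "P22 4 = [:1, 0, -5, 0, 4:]"
proof -
  have "c22 4 0 = 1" "c22 4 1 = 0" "c22 4 2 = -5" "c22 4 3 = 0" "c22 4 4 = 4"
    by code_simp+
  then show ?thesis
    by (simp add: P22_def numeral_eq_Suc monom_Suc monom_0)
qed

end

theory Submission
  imports Defs
begin

text \<open>
  The coefficient \<open>c22 n k\<close> vanishes unless \<open>k\<close> has the parity of \<open>n\<close>, so \<open>P22 n\<close> is an even
  or an odd function according to the parity of \<open>n\<close>. For \<open>m\<close> and \<open>n\<close> of different parity the
  product \<open>P22 n * P22 m\<close> is therefore odd, and its integral over the symmetric interval is
  its own negative.
\<close>

lemma poly_P22_minus: "poly (P22 n) (- x) = (-1) ^ n * poly (P22 n) x"
proof -
  have "of_int (c22 n k) * (- x) ^ k = (-1) ^ n * (of_int (c22 n k) * x ^ k)" for k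
    by (simp add: c22_def power_minus[of x k] uminus_power_if)
  then show ?thesis
    unfolding P22_def poly_sum poly_monom sum_distrib_left by (intro sum.cong refl)
qed

lemma has_integral_odd_symmetric:
  fixes f :: "real \<Rightarrow> real"
  assumes "f integrable_on {-a..a}" and odd: "\<And>x. f (- x) = - f x"
  shows "(f has_integral 0) {-a..a}"
proof -
  obtain I where I: "(f has_integral I) {-a..a}"
    using assms(1) by blast
  have "((\<lambda>x. f (- x)) has_integral I) {-a..a}"
    using I has_integral_reflect_real[of f I a "- a"] by simp
  moreover have "((\<lambda>x. f (- x)) has_integral - I) {-a..a}"
    using has_integral_neg[OF I] by (simp add: odd)
  ultimately have "I = - I"
    by (rule has_integral_unique)
  with I show ?thesis
    by simp
qed

theorem theorem3p3:
  fixes m n :: nat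
  assumes "m \<ge> 2" and "n \<ge> 2" and "even m \<noteq> even n"
  shows "((\<lambda>x::real. poly (P22 n) x * poly (P22 m) x) has_integral 0) {-1..1}"
proof (rule has_integral_odd_symmetric)
  show "(\<lambda>x. poly (P22 n) x * poly (P22 m) x) integrable_on {-1..1}"
    by (intro integrable_continuous_real continuous_intros)
  show "poly (P22 n) (- x) * poly (P22 m) (- x) = - (poly (P22 n) x * poly (P22 m) x)" for x
    using assms(3) by (auto simp: poly_P22_minus uminus_power_if)
qed

end
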